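(* Let $\alpha$ be a confluent non-expansive partial action of a monoid $M$ on a weak pseudometric space $(X,d)$, and let $(Y,D)$ be its free (weak pseudometric) globalization. If $\alpha$ is closed and $X$ is separated, then $Y$ is separated.
   Context: A weak pseudometric on $X$ is a symmetric function $d:X\times X\to[0,\infty]$ satisfying the triangle inequality and $d(x,x)=0$; the space is separated if $d(x,y)=0$ implies $x=y$. Topological notions refer to the topology induced by $d$. Partial action: a partial map $M\times X\to X$, $(u,x)\mapsto u\cdot x$, with $e\cdot x=x$ for all $x$ ($e$ the unit of $M$) and such that, whenever $v\cdot x$ is defined, $(uv)\cdot x$ is defined iff $u\cdot(v\cdot x)$ is defined, in which case they are equal. $\operatorname{dom}(u)$ is the set of $x\in X$ with $u\cdot x$ defined. It is non-expansive if $d(u\cdot x,u\cdot y)\le d(x,y)$ for all $u\in M$, $x,y\in\operatorname{dom}(u)$, and closed if $\operatorname{dom}(u)$ is closed in $X$ for each $u\in M$. Globalization: $Y=(M\times X)/{\simeq}$, where $\simeq$ is the equivalence relation generated by $(uv,x)\sim(u,v\cdot x)$ whenever $v\cdot x$ is defined; $[u,x]$ is the class of $(u,x)$. $M$ acts on $Y$ by $u\cdot[v,x]=[uv,x]$. The distance $D(a,b)$ on $Y$ is the infimum (with $\inf\emptyset=\infty$) of $\sum_{j=1}^n d(x_j,y_j)$ over all paths from $a$ to $b$, i.e. finite sequences $((u_j,x_j,y_j))_{j=1}^n$, $n\ge1$, $u_j\in M$, $x_j,y_j\in X$, with $[u_1,x_1]=a$, $[u_j,y_j]=[u_{j+1},x_{j+1}]$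 for $1\le j<n$, and $[u_n,y_n]=b$. Confluence: A monoid presentation $\langle G\mid R\rangle$ consists of a set $G$ and a set $R\subset G^*\times G^*$ of directed reduction rules $l\to r$ ($G^*$ is the set of finite words over $G$). It induces a one-step reduction $w_1lw_2\to w_1rw_2$ on $G^*$; the presented monoid is $G^*$ modulo the equivalence relation generated by $\to$. A word is normal if no one-step reduction applies to it; a normal form of $w$ is a normal word equivalent to $w$. The presentation is confluent if there is no infinite sequence of one-step reductions, every word has a unique normal form, and no rule has a left side consisting of a single letter. Given a presentation of $M$, one-step reduction on $G^*\times X$ is defined by $(g_n\dots g_1,x)\to(g_n\dots g_2,g_1\cdot x)$ whenever $g_1\cdot x$ is defined, and $(w_1,x)\to(w_2,x)$ whenever $w_1\to w_2$ in $G^*$; normality and normal forms are defined as before. The partial action is confluent if $M$ has a confluent presentation $\langle G\mid R\rangle$ such that every element of $G^*\times X$ has a unique normal form and, whenever $(g_n\dots g_1)\cdot x=y$ holds in $X$ (with $g_i\in G$), $(g_n\dots g_1,x)$ can be transformed into $((),y)$ by finitely many one-step reductions, where $()$ is the empty word. *)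

theory Defs
  imports "HOL-Library.Extended_Nonnegative_Real" "HOL-Analysis.Abstract_Topology"
begin

section \<open>Weak pseudometrics\<close>

definition weak_pseudometric :: "('x \<Rightarrow> 'x \<Rightarrow> ennreal) \<Rightarrow> bool" where
  "weak_pseudometric d \<longleftrightarrow>
     (\<forall>x. d x x = 0) \<and> (\<forall>x y. d x y = d y x) \<and> (\<forall>x y z. d x z \<le> d x y + d y z)"

definition separated_on :: "'x set \<Rightarrow> ('x \<Rightarrow> 'x \<Rightarrow> ennreal) \<Rightarrow> bool" where
  "separated_on S d \<longleftrightarrow> (\<forall>x\<in>S. \<forall>y\<in>S. d x y = 0 \<longrightarrow> x = y)"

definition wpm_topology :: "('x \<Rightarrow> 'x \<Rightarrow> ennreal) \<Rightarrow> 'x topology" where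
  "wpm_topology d =
     topology (\<lambda>U. \<forall>x\<in>U. \<exists>\<epsilon>::real. \<epsilon> > 0 \<and> (\<forall>y. d x y < ennreal \<epsilon> \<longrightarrow> y \<in> U))"

lemma openin_wpm_topology:
  "openin (wpm_topology d) U \<longleftrightarrow>
     (\<forall>x\<in>U. \<exists>\<epsilon>::real. \<epsilon> > 0 \<and> (\<forall>y. d x y < ennreal \<epsilon> \<longrightarrow> y \<in> U))"
proof -
  have "istopology (\<lambda>U. \<forall>x\<in>U. \<exists>\<epsilon>::real. \<epsilon> > 0 \<and> (\<forall>y. d x y < ennreal \<epsilon> \<longrightarrow> y \<in> U))"
    unfolding istopology_def
  proof (intro conjI allI impI ballI)
    fix S T x
    assume S: "\<forall>x\<in>S. \<exists>\<epsilon>::real. \<epsilon> > 0 \<and> (\<forall>y. d x y < ennreal \<epsilon> \<longrightarrow> y \<in> S)"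
      and T: "\<forall>x\<in>T. \<exists>\<epsilon>::real. \<epsilon> > 0 \<and> (\<forall>y. d x y < ennreal \<epsilon> \<longrightarrow> y \<in> T)"
      and x: "x \<in> S \<inter> T"
    from S x obtain a :: real where a: "a > 0" "\<And>y. d x y < ennreal a \<Longrightarrow> y \<in> S" by blast
    from T x obtain b :: real where b: "b > 0" "\<And>y. d x y < ennreal b \<Longrightarrow> y \<in> T" by blast
    have "ennreal (min a b) \<le> ennreal a" "ennreal (min a b) \<le> ennreal b"
      by (auto intro: ennreal_leI)
    then have "\<forall>y. d x y < ennreal (min a b) \<longrightarrow> y \<in> S \<inter> T"
      using a(2) b(2) by (meson IntI order_less_le_trans)
    with a(1) b(1) show "\<exists>\<epsilon>::real. \<epsilon> > 0 \<and> (\<forall>y. d x y < ennreal \<epsilon> \<longrightarrow> y \<in> S \<inter> T)"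
      by (intro exI[of _ "min a b"]) simp
  next
    fix K x
    assume K: "\<forall>U\<in>K. \<forall>x\<in>U. \<exists>\<epsilon>::real. \<epsilon> > 0 \<and> (\<forall>y. d x y < ennreal \<epsilon> \<longrightarrow> y \<in> U)"
      and "x \<in> \<Union>K"
    then obtain U where U: "U \<in> K" "x \<in> U" by blast
    with K obtain a :: real where "a > 0" "\<forall>y. d x y < ennreal a \<longrightarrow> y \<in> U" by blast
    with U show "\<exists>\<epsilon>::real. \<epsilon> > 0 \<and> (\<forall>y. d x y < ennreal \<epsilon> \<longrightarrow> y \<in> \<Union>K)" by blast
  qed
  then show ?thesis
    by (simp add: wpm_topology_def topology_inverse')
qed

lemma topspace_wpm_topology [simp]: "topspace (wpm_topology d) = UNIV"
proof -
  have "openin (wpm_topology d) UNIV"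
    by (auto simp: openin_wpm_topology intro: exI[of _ 1])
  then show ?thesis
    using openin_subset by blast
qed


section \<open>Partial actions\<close>

text \<open>
  A partial map \<open>M \<times> X \<rightarrow> X\<close> is a function \<open>act\<close> with \<open>act u :: 'x \<rightharpoonup> 'x\<close>, so that
  \<open>dom (act u)\<close> is the domain of \<open>u\<close>. The equation between options below states at once that
  one side is defined iff the other one is and that the values agree.
\<close>

definition partial_action :: "('m::monoid_mult \<Rightarrow> 'x \<rightharpoonup> 'x) \<Rightarrow> bool" where
  "partial_action act \<longleftrightarrow>
     (\<forall>x. act 1 x = Some x) \<and>
     (\<forall>u v x y. act v x = Some y \<longrightarrow> act (u * v) x = act u y)"

definition nonexpansive_action ::
  "('x \<Rightarrow> 'x \<Rightarrow> ennreal) \<Rightarrow> ('m::monoid_mult \<Rightarrow> 'x \<rightharpoonup> 'x) \<Rightarrow> bool" where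
  "nonexpansive_action d act \<longleftrightarrow>
     (\<forall>u. \<forall>x\<in>dom (act u). \<forall>y\<in>dom (act u). d (the (act u x)) (the (act u y)) \<le> d x y)"

definition closed_action ::
  "('x \<Rightarrow> 'x \<Rightarrow> ennreal) \<Rightarrow> ('m::monoid_mult \<Rightarrow> 'x \<rightharpoonup> 'x) \<Rightarrow> bool" where
  "closed_action d act \<longleftrightarrow> (\<forall>u. closedin (wpm_topology d) (dom (act u)))"


section \<open>The globalization and its distance\<close>

inductive glob_step :: "('m::monoid_mult \<Rightarrow> 'x \<rightharpoonup> 'x) \<Rightarrow> 'm \<times> 'x \<Rightarrow> 'm \<times> 'x \<Rightarrow> bool"
  for act where
  "act v x = Some y \<Longrightarrow> glob_step act (u * v, x) (u, y)"

definition glob_rel :: "('m::monoid_mult \<Rightarrow> 'x \<rightharpoonup> 'x) \<Rightarrow> (('m \<times> 'x) \<times> ('m \<times> 'x)) set" where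
  "glob_rel act = {(p, q). equivclp (glob_step act) p q}"

definition globalization :: "('m::monoid_mult \<Rightarrow> 'x \<rightharpoonup> 'x) \<Rightarrow> ('m \<times> 'x) set set" where
  "globalization act = UNIV // glob_rel act"

definition glob_class :: "('m::monoid_mult \<Rightarrow> 'x \<rightharpoonup> 'x) \<Rightarrow> 'm \<Rightarrow> 'x \<Rightarrow> ('m \<times> 'x) set" where
  "glob_class act u x = glob_rel act `` {(u, x)}"

definition glob_path ::
  "('m::monoid_mult \<Rightarrow> 'x \<rightharpoonup> 'x) \<Rightarrow> ('m \<times> 'x) set \<Rightarrow> ('m \<times> 'x) set \<Rightarrow> ('m \<times> 'x \<times> 'x) list \<Rightarrow> bool"
  where
  "glob_path act a b p \<longleftrightarrow>
     p \<noteq> [] \<and>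
     (case hd p of (u, x, y) \<Rightarrow> glob_class act u x = a) \<and>
     (\<forall>j. Suc j < length p \<longrightarrow>
        (case (p ! j, p ! Suc j) of ((u, x, y), (u', x', y')) \<Rightarrow>
           glob_class act u y = glob_class act u' x')) \<and>
     (case last p of (u, x, y) \<Rightarrow> glob_class act u y = b)"

definition path_length :: "('x \<Rightarrow> 'x \<Rightarrow> ennreal) \<Rightarrow> ('m \<times> 'x \<times> 'x) list \<Rightarrow> ennreal" where
  "path_length d p = (\<Sum>(u, x, y)\<leftarrow>p. d x y)"

definition glob_dist ::
  "('m::monoid_mult \<Rightarrow> 'x \<rightharpoonup> 'x) \<Rightarrow> ('x \<Rightarrow> 'x \<Rightarrow> ennreal) \<Rightarrow>
     ('m \<times> 'x) set \<Rightarrow> ('m \<times> 'x) set \<Rightarrow> ennreal" where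
  "glob_dist act d a b = Inf {path_length d p | p. glob_path act a b p}"


section \<open>Confluence\<close>

definition is_normal :: "('a \<Rightarrow> 'a \<Rightarrow> bool) \<Rightarrow> 'a \<Rightarrow> bool" where
  "is_normal step a \<longleftrightarrow> \<not> (\<exists>b. step a b)"

definition normal_form_of :: "('a \<Rightarrow> 'a \<Rightarrow> bool) \<Rightarrow> 'a \<Rightarrow> 'a \<Rightarrow> bool" where
  "normal_form_of step a b \<longleftrightarrow> is_normal step b \<and> equivclp step a b"

inductive word_step :: "'g set \<Rightarrow> ('g list \<times> 'g list) set \<Rightarrow> 'g list \<Rightarrow> 'g list \<Rightarrow> bool"
  for G R where
  "(l, r) \<in> R \<Longrightarrow> w1 \<in> lists G \<Longrightarrow> w2 \<in> lists G \<Longrightarrow> word_step G R (w1 @ l @ w2) (w1 @ r @ w2)"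

text \<open>
  \<open>\<phi>\<close> sends a generator to the element of the monoid it stands for. The last two conjuncts say that
  its extension to words induces a bijection, hence an isomorphism, from \<open>G\<^sup>*\<close> modulo the
  equivalence generated by one-step reduction onto the monoid \<open>'m\<close>.
\<close>

definition monoid_presentation ::
  "'g set \<Rightarrow> ('g list \<times> 'g list) set \<Rightarrow> ('g \<Rightarrow> 'm::monoid_mult) \<Rightarrow> bool" where
  "monoid_presentation G R \<phi> \<longleftrightarrow>
     R \<subseteq> lists G \<times> lists G \<and>
     (\<lambda>w. prod_list (map \<phi> w)) ` lists G = UNIV \<and>
     (\<forall>w\<in>lists G. \<forall>w'\<in>lists G.
        prod_list (map \<phi> w) = prod_list (map \<phi> w') \<longleftrightarrow> equivclp (word_step G R) w w')"

definition confluent_presentation :: "'g set \<Rightarrow> ('g list \<times> 'g list) set \<Rightarrow> bool" where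
  "confluent_presentation G R \<longleftrightarrow>
     \<not> (\<exists>f :: nat \<Rightarrow> 'g list. \<forall>i. word_step G R (f i) (f (Suc i))) \<and>
     (\<forall>w\<in>lists G. \<exists>!v. normal_form_of (word_step G R) w v) \<and>
     (\<forall>(l, r)\<in>R. length l \<noteq> 1)"

text \<open>A word \<open>g\<^sub>n \<dots> g\<^sub>1\<close> acts from the right end, so the letter \<open>g\<^sub>1\<close> applied first is the last
  entry of the list.\<close>

inductive pair_step ::
  "'g set \<Rightarrow> ('g list \<times> 'g list) set \<Rightarrow> ('g \<Rightarrow> 'm::monoid_mult) \<Rightarrow> ('m \<Rightarrow> 'x \<rightharpoonup> 'x) \<Rightarrow>
     'g list \<times> 'x \<Rightarrow> 'g list \<times> 'x \<Rightarrow> bool"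
  for G R \<phi> act where
  apply_letter: "w \<in> lists G \<Longrightarrow> g \<in> G \<Longrightarrow> act (\<phi> g) x = Some y \<Longrightarrow>
     pair_step G R \<phi> act (w @ [g], x) (w, y)"
| reduce_word: "word_step G R w1 w2 \<Longrightarrow> pair_step G R \<phi> act (w1, x) (w2, x)"

text \<open>
  HOL cannot quantify existentially over the type of the generators, so this type is an explicit
  parameter. In a hypothesis of a theorem that is polymorphic in \<open>'g\<close>, the condition
  \<open>confluent_action TYPE('g) act\<close> covers presentations with generators of any type.
\<close>

definition confluent_action :: "'g itself \<Rightarrow> ('m::monoid_mult \<Rightarrow> 'x \<rightharpoonup> 'x) \<Rightarrow> bool" where
  "confluent_action T act \<longleftrightarrow>
     (\<exists>(G :: 'g set) R (\<phi> :: 'g \<Rightarrow> 'm).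
        monoid_presentation G R \<phi> \<and>
        confluent_presentation G R \<and>
        (\<forall>w\<in>lists G. \<forall>x. \<exists>!q. normal_form_of (pair_step G R \<phi> act) (w, x) q) \<and>
        (\<forall>w\<in>lists G. \<forall>x y. act (prod_list (map \<phi> w)) x = Some y \<longrightarrow>
           (pair_step G R \<phi> act)\<^sup>*\<^sup>* (w, x) ([], y)))"

end

theory Submission
  imports Defs
begin

text \<open>
  Represent points of the globalization by normal pairs \<open>(w, x)\<close>, where \<open>w\<close> is a normal word whose
  first acting letter is not defined at \<open>x\<close>. By non-expansiveness, a segment \<open>(u, x, y)\<close> of a path may
  be shortened as long as the first acting letter of \<open>u\<close> is defined at both \<open>x\<close> and \<open>y\<close>; afterwards it
  either goes up (only \<open>(u, y)\<close> is normal), goes down (only \<open>(u, x)\<close> is normal) or is flat. A segment going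
  up followed by one going down can be merged and shortened, so that every path can be replaced by
  one going down, then flat, then up. As the domains are closed, short paths out of \<open>(w, x)\<close> cannot begin by
  going down, and short paths into \<open>(v, y)\<close> cannot end by going up. Hence only a flat segment
  is left, whose length is \<open>d x y\<close>.
\<close>

section \<open>Words, pairs and their normality\<close>

lemma equivclp_map:
  assumes "equivclp r a b" and "\<And>a b. r a b \<Longrightarrow> equivclp s (f a) (f b)"
  shows "equivclp s (f a) (f b)"
  using assms(1)
proof (induction rule: equivclp_induct)
  case (step y z)
  then have "equivclp s (f y) (f z)" by (auto intro: assms(2) equivclp_sym)
  with step.IH show ?case by (rule equivclp_trans)
qed simp

text \<open>Fixes one presentation witnessing confluence, so that words can stand for elements of
  the monoid.\<close>

locale presented_action =
  fixes G :: "'g set" and R and \<phi> :: "'g \<Rightarrow> 'm::monoid_mult" and act :: "'m \<Rightarrow> 'x \<rightharpoonup> 'x"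
  assumes pres: "monoid_presentation G R \<phi>"
    and conf: "confluent_presentation G R"
    and unique_nf: "\<And>w x. w \<in> lists G \<Longrightarrow> \<exists>!q. normal_form_of (pair_step G R \<phi> act) (w, x) q"
    and reduces: "\<And>w x y. w \<in> lists G \<Longrightarrow> act (prod_list (map \<phi> w)) x = Some y \<Longrightarrow>
           (pair_step G R \<phi> act)\<^sup>*\<^sup>* (w, x) ([], y)"
begin

abbreviation val :: "'g list \<Rightarrow> 'm" where "val w \<equiv> prod_list (map \<phi> w)"

abbreviation step where "step \<equiv> pair_step G R \<phi> act"

abbreviation cls :: "'g list \<times> 'x \<Rightarrow> ('m \<times> 'x) set" where
  "cls p \<equiv> glob_class act (val (fst p)) (snd p)"

lemma word_step_lists:
  assumes "word_step G R v w" shows "v \<in> lists G" "w \<in> lists G"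
proof -
  have "R \<subseteq> lists G \<times> lists G" using pres by (simp add: monoid_presentation_def)
  with assms show "v \<in> lists G" "w \<in> lists G" by (force elim!: word_step.cases)+
qed

lemma word_equiv_lists:
  assumes "equivclp (word_step G R) v w" "v \<in> lists G" shows "w \<in> lists G"
  using assms by (induction rule: equivclp_induct) (auto dest: word_step_lists)

lemma word_exists:
  obtains w where "w \<in> lists G" "val w = u"
proof -
  have "u \<in> val ` lists G" using pres by (simp add: monoid_presentation_def)
  then show ?thesis using that by blast
qed

lemma val_eq_iff:
  "v \<in> lists G \<Longrightarrow> w \<in> lists G \<Longrightarrow> val v = val w \<longleftrightarrow> equivclp (word_step G R) v w"
  using pres unfolding monoid_presentation_def by blast

lemma normal_word_exists:
  obtains w where "w \<in> lists G" "is_normal (word_step G R) w" "val w = u"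
proof -
  obtain v where v: "v \<in> lists G" "val v = u" by (rule word_exists)
  have "\<exists>!w. normal_form_of (word_step G R) v w"
    using conf v(1) unfolding confluent_presentation_def by blast
  then obtain w where w: "is_normal (word_step G R) w" "equivclp (word_step G R) v w"
    unfolding normal_form_of_def by blast
  with v have "w \<in> lists G" using word_equiv_lists by blast
  with v w show ?thesis using that val_eq_iff by metis
qed

text \<open>A reduction inside \<open>v\<close> is also one inside \<open>v @ w\<close>. This keeps
  the word normal when its first acting letters, at the right end, are stripped off.\<close>

lemma normal_word_prefix:
  assumes "is_normal (word_step G R) (v @ w)" "w \<in> lists G"
  shows "is_normal (word_step G R) v"
  unfolding is_normal_def
proof
  assume "\<exists>v'. word_step G R v v'"
  then obtain v' where "word_step G R v v'" ..
  then have "word_step G R (v @ w) (v' @ w)"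
  proof cases
    case (1 l r w1 w2)
    then show ?thesis using word_step.intros[OF 1(3,4), of "w2 @ w"] 1(5) assms(2) by simp
  qed
  with assms(1) show False by (auto simp: is_normal_def)
qed

lemma word_step_append_left:
  assumes "word_step G R v v'" "w \<in> lists G" shows "word_step G R (w @ v) (w @ v')"
  using assms(1)
proof cases
  case (1 l r w1 w2)
  then show ?thesis using word_step.intros[OF 1(3), of "w @ w1" G w2] assms(2) by simp
qed

text \<open>Letters act from the right end, so letters added on the left do not interfere with a
  step.\<close>

lemma step_append_left:
  assumes "step (v, x) (v', y)" "w \<in> lists G"
  shows "step (w @ v, x) (w @ v', y)"
  using assms(1)
proof cases
  case (apply_letter g)
  then show ?thesis
    using pair_step.apply_letter[of "w @ v'" G g act \<phi> x y R] assms(2) by simp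
next
  case reduce_word
  then show ?thesis using assms(2) by (auto intro: pair_step.reduce_word word_step_append_left)
qed

lemma normal_pairD:
  assumes "is_normal step (w @ [g], x)" "w @ [g] \<in> lists G"
  shows "act (\<phi> g) x = None"
proof (rule ccontr)
  assume "act (\<phi> g) x \<noteq> None"
  then obtain y where "act (\<phi> g) x = Some y" by blast
  then have "step (w @ [g], x) (w, y)" using assms(2) by (auto intro: pair_step.apply_letter)
  with assms(1) show False by (auto simp: is_normal_def)
qed

text \<open>A pair admits only two kinds of step: a reduction of its word, or the application of the
  last letter.\<close>

lemma normal_pairI:
  assumes "is_normal (word_step G R) w" "w \<noteq> [] \<Longrightarrow> act (\<phi> (last w)) x = None"
  shows "is_normal step (w, x)"
  using assms by (auto simp: is_normal_def elim!: pair_step.cases)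

lemma step_equiv_lists:
  assumes "equivclp step p q" "fst p \<in> lists G" shows "fst q \<in> lists G"
  using assms by (induction rule: equivclp_induct)
    (auto elim!: pair_step.cases dest: word_step_lists)

section \<open>The globalization as pairs modulo reduction\<close>

lemma glob_class_eq_iff:
  "glob_class act u x = glob_class act v y \<longleftrightarrow> equivclp (glob_step act) (u, x) (v, y)"
  by (auto simp: glob_class_def glob_rel_def
      intro: equivclp_trans equivclp_sym dest: equivclp_sym)

lemma step_equiv_of_val_eq:
  assumes "v \<in> lists G" "w \<in> lists G" "val v = val w"
  shows "equivclp step (v, x) (w, x)"
proof -
  have "equivclp (word_step G R) v w" using assms val_eq_iff by blast
  then show ?thesis
    by (rule equivclp_map[where f = "\<lambda>w. (w, x)"]) (auto intro: pair_step.reduce_word)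
qed

text \<open>Confluence makes every defined action visible in reductions: a word \<open>z\<close> for
  \<open>v\<close> reduces at \<open>x\<close> to the empty word at \<open>y\<close>. Prefixing this
  reduction with \<open>w'\<close> joins \<open>(w' @ z, x)\<close> to \<open>(w', y)\<close>, and
  \<open>w' @ z\<close> has the same value as \<open>w\<close>.\<close>

lemma step_equiv_of_glob_step:
  assumes "act v x = Some y" "w \<in> lists G" "val w = u * v" "w' \<in> lists G" "val w' = u"
  shows "equivclp step (w, x) (w', y)"
proof -
  obtain z where z: "z \<in> lists G" "val z = v" by (rule word_exists)
  have "equivclp step (z, x) ([], y)"
    using reduces[of z x y] z assms(1) rtranclp_into_equivclp by metis
  \<comment> \<open>Both ends are written as images under one map of pairs, prefixing with
    \<open>w'\<close>, to fit \<open>equivclp_map\<close>.\<close>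
  then have "equivclp step (case (z, x) of (v, x) \<Rightarrow> (w' @ v, x))
      (case ([], y) of (v, x) \<Rightarrow> (w' @ v, x))"
  proof (rule equivclp_map)
    fix p q assume "step p q"
    then show "equivclp step (case p of (v, x) \<Rightarrow> (w' @ v, x)) (case q of (v, x) \<Rightarrow> (w' @ v, x))"
      using step_append_left[OF _ assms(4)] by (cases p; cases q) auto
  qed
  then have "equivclp step (w' @ z, x) (w', y)" by simp
  moreover have "equivclp step (w, x) (w' @ z, x)"
    using assms z by (intro step_equiv_of_val_eq) auto
  ultimately show ?thesis by (rule equivclp_trans[rotated])
qed

lemma step_equiv_of_glob_equiv:
  assumes "equivclp (glob_step act) (u, x) q" "w \<in> lists G" "val w = u"
    and "w' \<in> lists G" "val w' = fst q"
  shows "equivclp step (w, x) (w', snd q)"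
  using assms(1,4,5)
proof (induction arbitrary: w' rule: equivclp_induct)
  case base
  then show ?case using assms(2,3) step_equiv_of_val_eq by simp
next
  case (step p q)
  obtain z where z: "z \<in> lists G" "val z = fst p" by (rule word_exists)
  have "equivclp step (z, snd p) (w', snd q)"
    using step.hyps(2)
  proof
    assume "glob_step act p q"
    then show ?thesis
      using z step.prems by cases (auto intro: step_equiv_of_glob_step)
  next
    assume "glob_step act q p"
    then show ?thesis
      using z step.prems by cases (auto intro: equivclp_sym step_equiv_of_glob_step)
  qed
  with step.IH[OF z] show ?case by (rule equivclp_trans)
qed

text \<open>Points of the globalization are thus the classes of pairs under reduction, so the unique
  normal forms of pairs serve as canonical representatives.\<close>

lemma class_eq_iff:
  assumes "v \<in> lists G" "w \<in> lists G"
  shows "cls (v, x) = cls (w, y) \<longleftrightarrow> equivclp step (v, x) (w, y)"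
proof
  assume "cls (v, x) = cls (w, y)"
  then have "equivclp (glob_step act) (val v, x) (val w, y)" by (simp add: glob_class_eq_iff)
  from step_equiv_of_glob_equiv[OF this] assms show "equivclp step (v, x) (w, y)" by simp
next
  assume "equivclp step (v, x) (w, y)"
  then have "equivclp (glob_step act) (val (fst (v, x)), snd (v, x)) (val (fst (w, y)), snd (w, y))"
  proof (rule equivclp_map[where f = "\<lambda>p. (val (fst p), snd p)"])
    fix p q assume "step p q"
    then show "equivclp (glob_step act) (val (fst p), snd p) (val (fst q), snd q)"
    proof cases
      case (apply_letter w g x y)
      then show ?thesis using glob_step.intros[of act "\<phi> g" x y "val w"] by auto
    next
      case (reduce_word w1 w2 x)
      then have "val w1 = val w2" using word_step_lists val_eq_iff by blast
      then show ?thesis using reduce_word by simp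
    qed
  qed
  then show "cls (v, x) = cls (w, y)" by (simp add: glob_class_eq_iff)
qed

lemma class_apply_letter:
  assumes "v @ [g] \<in> lists G" "act (\<phi> g) x = Some y"
  shows "cls (v @ [g], x) = cls (v, y)"
  using assms class_eq_iff[of "v @ [g]" v x y] by (auto intro: pair_step.apply_letter)

lemma normal_eq_of_class_eq:
  assumes "fst p \<in> lists G" "fst q \<in> lists G" "is_normal step p" "is_normal step q" "cls p = cls q"
  shows "p = q"
proof -
  have "equivclp step p q" using assms class_eq_iff[of "fst p" "fst q" "snd p" "snd q"] by simp
  then have "normal_form_of step p q" "normal_form_of step p p"
    using assms by (auto simp: normal_form_of_def)
  with unique_nf[of "fst p" "snd p"] assms(1) show ?thesis by auto
qed

lemma normal_pair_exists:
  assumes "a \<in> globalization act"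
  obtains p where "fst p \<in> lists G" "is_normal step p" "a = cls p"
proof -
  obtain u x where a: "a = glob_class act u x"
    using assms by (auto simp: globalization_def glob_class_def quotient_def)
  obtain w where w: "w \<in> lists G" "val w = u" by (rule word_exists)
  obtain p where p: "is_normal step p" "equivclp step (w, x) p"
    using unique_nf[OF w(1), of x] unfolding normal_form_of_def by blast
  then have "fst p \<in> lists G" using w step_equiv_lists by fastforce
  moreover have "a = cls p"
    using class_eq_iff[OF w(1) calculation, of x "snd p"] p(2) a w(2) by simp
  ultimately show ?thesis using that p(1) by blast
qed

section \<open>Ascending paths and their extension by a segment\<close>

text \<open>
  Normal pairs reachable from \<open>p0\<close> by a path of length at most \<open>L\<close> that starts with a flat segment and
  then only goes up.
\<close>

inductive ascends :: "('x \<Rightarrow> 'x \<Rightarrow> ennreal) \<Rightarrow> 'g list \<times> 'x \<Rightarrow> 'g list \<times> 'x \<Rightarrow> ennreal \<Rightarrow> bool"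
  for d p0 where
  flat: "p0 = (w, x) \<Longrightarrow> w \<in> lists G \<Longrightarrow> is_normal step (w, y) \<Longrightarrow> d x y \<le> L \<Longrightarrow> ascends d p0 (w, y) L"
| up: "ascends d p0 p L \<Longrightarrow> w @ [g] \<in> lists G \<Longrightarrow> cls (w @ [g], x) = cls p \<Longrightarrow>
     act (\<phi> g) x \<noteq> None \<Longrightarrow> is_normal step (w @ [g], y) \<Longrightarrow> L + d x y \<le> L' \<Longrightarrow>
     ascends d p0 (w @ [g], y) L'"

lemma ascends_normal: "ascends d p0 p L \<Longrightarrow> fst p \<in> lists G \<and> is_normal step p"
  by (induction rule: ascends.induct) auto

text \<open>A flat segment is absorbed into the last segment of the ascent by the triangle
  inequality.\<close>

lemma ascends_flat:
  assumes d: "weak_pseudometric d"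
    and "ascends d p0 (w, x) L" "is_normal step (w, y)" "L + d x y \<le> L'"
  shows "ascends d p0 (w, y) L'"
  using assms(2)
proof cases
  case (flat x0)
  have "d x0 y \<le> d x0 x + d x y" using d unfolding weak_pseudometric_def by blast
  also have "\<dots> \<le> L'" using flat assms(4) by (meson add_right_mono order_trans)
  finally show ?thesis using flat assms(3) by (auto intro: ascends.flat)
next
  case (up p L0 w' g x')
  have "L0 + d x' y \<le> L0 + d x' x + d x y"
    using d unfolding weak_pseudometric_def add.assoc by (blast intro: add_left_mono)
  also have "\<dots> \<le> L'" using up assms(4) by (meson add_right_mono order_trans)
  finally have "L0 + d x' y \<le> L'" .
  then show ?thesis using ascends.up[OF up(2-5), of y L'] up(1) assms(3) by simp
qed

text \<open>Induction on the word strips its first acting letter while this letter is defined at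
  both ends; the segment left over is flat, up or down. The down case is a hypothesis because its
  treatment depends on how the ascent reached \<open>p\<close>.\<close>

lemma ascends_segment_unless_down:
  assumes d: "weak_pseudometric d" and ne: "nonexpansive_action d act"
    and asc: "ascends d p0 p L"
    and down: "\<And>w g x y. p = (w @ [g], x) \<Longrightarrow> act (\<phi> g) y \<noteq> None \<Longrightarrow> L + d x y \<le> L' \<Longrightarrow>
      \<exists>q. cls (w @ [g], y) = cls q \<and> ascends d p0 q L'"
    and "v \<in> lists G" "is_normal (word_step G R) v"
    and "cls (v, x) = cls p" "L + d x y \<le> L'"
  shows "\<exists>q. cls (v, y) = cls q \<and> ascends d p0 q L'"
  using assms(5-)
proof (induction v arbitrary: x y rule: rev_induct)
  case Nil
  have "p = ([], x)"
    using Nil ascends_normal[OF asc] by (intro normal_eq_of_class_eq) (auto intro: normal_pairI)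
  with asc have "ascends d p0 ([], x) L" by simp
  moreover have "is_normal step ([], y)" using Nil by (intro normal_pairI) simp_all
  ultimately have "ascends d p0 ([], y) L'" using Nil.prems(4) by (rule ascends_flat[OF d])
  then show ?case by blast
next
  case (snoc g v)
  \<comment> \<open>If \<open>g\<close> is undefined at \<open>x\<close>, the pair is normal and so
    is the only normal representative of its class.\<close>
  have p_eq: "p = (v @ [g], x)" if "act (\<phi> g) x = None"
    using snoc.prems that ascends_normal[OF asc]
    by (intro normal_eq_of_class_eq) (auto intro: normal_pairI)
  show ?case
  proof (cases "act (\<phi> g) y")
    case None
    then have n: "is_normal step (v @ [g], y)"
      using snoc.prems by (auto intro: normal_pairI)
    have "ascends d p0 (v @ [g], y) L'"
    proof (cases "act (\<phi> g) x")
      case None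
      with asc have "ascends d p0 (v @ [g], x) L" by (simp only: p_eq)
      then show ?thesis using n snoc.prems(4) by (rule ascends_flat[OF d])
    next
      case (Some x')
      then show ?thesis using ascends.up[OF asc snoc.prems(1,3) _ n snoc.prems(4)] by simp
    qed
    then show ?thesis by blast
  next
    case y': (Some y')
    show ?thesis
    proof (cases "act (\<phi> g) x")
      case None
      then show ?thesis using y' snoc.prems down p_eq by simp
    next
      case (Some x')
      \<comment> \<open>Non-expansiveness: moving the segment along \<open>g\<close> does not
        lengthen it.\<close>
      have "d x' y' \<le> d x y"
        using ne y' Some unfolding nonexpansive_action_def by (metis domI option.sel)
      then have "L + d x' y' \<le> L'" using snoc.prems(4) by (meson add_left_mono order_trans)
      moreover have "cls (v @ [g], x) = cls (v, x')" "cls (v @ [g], y) = cls (v, y')"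
        using snoc.prems(1) y' Some by (simp_all only: class_apply_letter)
      moreover have "is_normal (word_step G R) v"
        using snoc.prems normal_word_prefix by auto
      ultimately show ?thesis using snoc.IH[of x' y'] snoc.prems(1,3) by simp
    qed
  qed
qed

text \<open>Induction on the ascent disposes of a segment going down. After a flat start it would
  bring a point of the domain of the letter within \<open>e\<close> of the second component of
  \<open>p0\<close>, against \<open>ball\<close>. After an upward segment the two merge into one
  that the shorter ascent can absorb.\<close>

lemma ascends_segment:
  assumes d: "weak_pseudometric d" and ne: "nonexpansive_action d act"
    and ball: "\<forall>w g x y. p0 = (w @ [g], x) \<longrightarrow> d x y < e \<longrightarrow> act (\<phi> g) y = None"
    and "ascends d p0 p L" "v \<in> lists G" "is_normal (word_step G R) v"
    and "cls (v, x) = cls p" "L + d x y \<le> L'" "L' < e"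
  shows "\<exists>q. cls (v, y) = cls q \<and> ascends d p0 q L'"
  using assms(4-)
proof (induction arbitrary: v x y L' rule: ascends.induct)
  case (flat w x0 x1 L)
  from flat(1-4) have asc: "ascends d p0 (w, x1) L" by (rule ascends.flat)
  show ?case
  proof (rule ascends_segment_unless_down[OF d ne asc _ flat(5-8)])
    fix w' g x y assume *: "(w, x1) = (w' @ [g], x)" "act (\<phi> g) y \<noteq> None" "L + d x y \<le> L'"
    have "d x0 y \<le> d x0 x + d x y" using d unfolding weak_pseudometric_def by blast
    also have "\<dots> \<le> L'" using * flat(4) by (auto intro: order_trans add_right_mono)
    finally have "act (\<phi> g) y = None" using * flat(1) \<open>L' < e\<close> ball by auto
    with * show "\<exists>q. cls (w' @ [g], y) = cls q \<and> ascends d p0 q L'" by simp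
  qed
next
  case (up p L w g x1 x2 L1)
  from up(1-6) have asc: "ascends d p0 (w @ [g], x2) L1" by (rule ascends.up)
  show ?case
  proof (rule ascends_segment_unless_down[OF d ne asc _ up(8-11)])
    fix w' g' x y assume *: "(w @ [g], x2) = (w' @ [g'], x)" "act (\<phi> g') y \<noteq> None" "L1 + d x y \<le> L'"
    have "L + d x1 y \<le> L + d x1 x + d x y"
      using d unfolding weak_pseudometric_def add.assoc by (blast intro: add_left_mono)
    also have "\<dots> \<le> L'" using * up(6) by (auto intro: order_trans add_right_mono)
    finally have le: "L + d x1 y \<le> L'" .
    have "is_normal (word_step G R) (w @ [g])"
      using up(5) by (auto simp: is_normal_def intro: pair_step.reduce_word)
    \<comment> \<open>The merged segment runs from \<open>x1\<close> straight to \<open>y\<close>,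
      over the same word, and is attached to the ascent ending at \<open>p\<close>.\<close>
    from up.IH[OF up(2) this up(3) le \<open>L' < e\<close>] *
    show "\<exists>q. cls (w' @ [g'], y) = cls q \<and> ascends d p0 q L'" by simp
  qed
qed

section \<open>From arbitrary paths to ascents\<close>

lemma glob_path_Cons:
  assumes "glob_path act a b ((u, x, y) # p)" "p \<noteq> []"
  shows "glob_path act (glob_class act u y) b p"
proof -
  have adj: "\<forall>j. Suc j < length ((u, x, y) # p) \<longrightarrow>
      (case (((u, x, y) # p) ! j, ((u, x, y) # p) ! Suc j) of
        ((u, x, y), (u', x', y')) \<Rightarrow> glob_class act u y = glob_class act u' x')"
    using assms(1) unfolding glob_path_def by (elim conjE)
  from spec[OF adj, of 0] have "case hd p of (u', x', y') \<Rightarrow> glob_class act u' x' = glob_class act u y"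
    using assms(2) by (cases p) auto
  moreover have "\<forall>j. Suc j < length p \<longrightarrow> (case (p ! j, p ! Suc j) of
      ((u, x, y), (u', x', y')) \<Rightarrow> glob_class act u y = glob_class act u' x')"
  proof
    fix j
    from spec[OF adj, of "Suc j"] show "Suc j < length p \<longrightarrow> (case (p ! j, p ! Suc j) of
        ((u, x, y), (u', x', y')) \<Rightarrow> glob_class act u y = glob_class act u' x')" by simp
  qed
  ultimately show ?thesis
    using assms by (auto simp: glob_path_def)
qed

text \<open>The segments are absorbed one at a time; no partial length exceeds the total, so the
  bound \<open>e\<close> applies at every stage.\<close>

lemma ascends_path:
  assumes d: "weak_pseudometric d" and ne: "nonexpansive_action d act"
    and ball: "\<forall>w g x y. p0 = (w @ [g], x) \<longrightarrow> d x y < e \<longrightarrow> act (\<phi> g) y = None"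
    and "ascends d p0 p L" "glob_path act (cls p) b ps" "L + path_length d ps < e"
  shows "\<exists>q. b = cls q \<and> ascends d p0 q (L + path_length d ps)"
  using assms(4-)
proof (induction ps arbitrary: p L)
  case Nil
  then show ?case by (simp add: glob_path_def)
next
  case (Cons s ps)
  obtain u x y where s: "s = (u, x, y)" by (cases s)
  have len: "L + path_length d (s # ps) = L + d x y + path_length d ps"
    by (simp add: s path_length_def add.assoc)
  \<comment> \<open>A normal word for \<open>u\<close> is needed so that only the application of
    letters can reduce the ends of the segment.\<close>
  obtain v where v: "v \<in> lists G" "is_normal (word_step G R) v" "val v = u"
    by (rule normal_word_exists)
  have "L + d x y \<le> L + path_length d (s # ps)" by (simp add: len)
  then have "L + d x y < e" using Cons.prems(3) by (rule order_le_less_trans)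
  moreover have "cls (v, x) = cls p" using Cons.prems(2) s v(3) by (simp add: glob_path_def)
  ultimately obtain q where q: "cls (v, y) = cls q" "ascends d p0 q (L + d x y)"
    using ascends_segment[OF d ne ball Cons.prems(1) v(1,2)] by blast
  show ?case
  proof (cases "ps = []")
    case True
    then have "b = cls q" "path_length d (s # ps) = d x y"
      using Cons.prems(2) q(1) v(3) s by (simp_all add: glob_path_def path_length_def)
    with q(2) True show ?thesis by (intro exI[of _ q]) (simp add: len path_length_def)
  next
    case False
    have "glob_path act (cls q) b ps"
      using glob_path_Cons[of "cls p" b u x y ps] Cons.prems(2) False q(1) v(3) s by simp
    then show ?thesis
      using Cons.IH[OF q(2)] Cons.prems(3) unfolding len by blast
  qed
qed

section \<open>Closed domains and separation\<close>

text \<open>The last letter of the word of a normal pair is undefined at its point, and the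
  complement of the domain of that letter is open. For the empty word the condition is vacuous and
  any positive radius does.\<close>

lemma closed_ball:
  assumes "closed_action d act" "is_normal step p" "fst p \<in> lists G"
  obtains e :: ennreal where "e > 0"
    "\<forall>w g x y. p = (w @ [g], x) \<longrightarrow> d x y < e \<longrightarrow> act (\<phi> g) y = None"
proof (cases "fst p" rule: rev_exhaust)
  case Nil
  then show ?thesis by (intro that[of 1]) auto
next
  case (snoc w g)
  have "openin (wpm_topology d) (- dom (act (\<phi> g)))"
    using assms(1) by (simp add: closed_action_def closedin_def Compl_eq_Diff_UNIV)
  moreover have "snd p \<in> - dom (act (\<phi> g))"
    using snoc assms normal_pairD[of w g "snd p"] by (metis ComplI domIff prod.collapse)
  ultimately obtain \<epsilon> :: real where "\<epsilon> > 0" "\<And>y. d (snd p) y < ennreal \<epsilon> \<Longrightarrow> y \<in> - dom (act (\<phi> g))"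
    unfolding openin_wpm_topology by blast
  then show ?thesis using snoc by (intro that[of "ennreal \<epsilon>"]) (auto simp: domIff)
qed

lemma separated_glob_dist:
  assumes d: "weak_pseudometric d" and ne: "nonexpansive_action d act"
    and cl: "closed_action d act" and sep: "separated_on UNIV d"
  shows "separated_on (globalization act) (glob_dist act d)"
  unfolding separated_on_def
proof (intro ballI impI)
  fix a b assume ab: "a \<in> globalization act" "b \<in> globalization act" "glob_dist act d a b = 0"
  obtain p where p: "fst p \<in> lists G" "is_normal step p" "a = cls p"
    using ab(1) by (rule normal_pair_exists)
  obtain q where q: "fst q \<in> lists G" "is_normal step q" "b = cls q"
    using ab(2) by (rule normal_pair_exists)
  obtain e where e: "e > 0"
    and e_ball: "\<forall>w g x y. p = (w @ [g], x) \<longrightarrow> d x y < e \<longrightarrow> act (\<phi> g) y = None"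
    using closed_ball[OF cl p(2,1)] by blast
  obtain e' where e': "e' > 0"
    and e'_ball: "\<forall>w g x y. q = (w @ [g], x) \<longrightarrow> d x y < e' \<longrightarrow> act (\<phi> g) y = None"
    using closed_ball[OF cl q(2,1)] by blast
  show "a = b"
  proof (rule ccontr)
    assume "a \<noteq> b"
    \<comment> \<open>\<open>m\<close> excludes a purely flat path from \<open>p\<close> to
      \<open>q\<close>. Such a path needs equal words, so in the other case any positive value will
      do.\<close>
    define m where "m = (if fst p = fst q then d (snd p) (snd q) else 1)"
    have "snd p \<noteq> snd q" if "fst p = fst q"
      using \<open>a \<noteq> b\<close> p q that by (auto simp: prod_eq_iff)
    then have "m > 0"
      using sep by (auto simp: m_def separated_on_def zero_less_iff_neq_zero)
    then have "glob_dist act d a b < min m (min e e')" using e e' ab(3) by simp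
    then obtain ps where ps: "glob_path act a b ps" "path_length d ps < min m (min e e')"
      unfolding glob_dist_def Inf_less_iff by blast
    \<comment> \<open>The path is absorbed starting from the trivial flat segment at
      \<open>p\<close>.\<close>
    have "ascends d p p 0"
      using p d ascends.flat[of p "fst p" "snd p" "snd p" d 0] by (simp add: weak_pseudometric_def)
    then have "\<exists>q'. b = cls q' \<and> ascends d p q' (0 + path_length d ps)"
      using ps p(3) by (intro ascends_path[OF d ne e_ball]) simp_all
    then obtain q' where q': "b = cls q'" "ascends d p q' (path_length d ps)" by auto
    have "q' = q"
      using q q' ascends_normal by (intro normal_eq_of_class_eq) auto
    with q'(2) have "ascends d p q (path_length d ps)" by simp
    then show False
    proof cases
      case (flat w x y)
      then show ?thesis using ps(2) by (auto simp: m_def)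
    next
      case (up p' L w g x y)
      \<comment> \<open>A final upward segment starts in the domain of \<open>g\<close>, yet within
        \<open>e'\<close> of the second component of \<open>q\<close>, which \<open>e'_ball\<close>
        forbids.\<close>
      have "d x y \<le> L + d x y" by simp
      also have "\<dots> \<le> path_length d ps" by (rule up(7))
      also have "\<dots> < e'" using ps(2) by simp
      finally have "d y x < e'" using d by (simp add: weak_pseudometric_def)
      then have "act (\<phi> g) x = None" using e'_ball up(1) by blast
      with up(5) show ?thesis by blast
    qed
  qed
qed

end

theorem theorem5p11:
  fixes d :: "'x \<Rightarrow> 'x \<Rightarrow> ennreal"
    and act :: "'m::monoid_mult \<Rightarrow> 'x \<rightharpoonup> 'x"
  assumes "weak_pseudometric d"
    and "partial_action act"
    and "nonexpansive_action d act"
    and "confluent_action TYPE('g) act"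
    and "closed_action d act"
    and "separated_on UNIV d"
  shows "separated_on (globalization act) (glob_dist act d)"
proof -
  obtain G :: "'g set" and R \<phi> where pres:
      "monoid_presentation G R \<phi>" "confluent_presentation G R"
      "\<forall>w\<in>lists G. \<forall>x. \<exists>!q. normal_form_of (pair_step G R \<phi> act) (w, x) q"
      "\<forall>w\<in>lists G. \<forall>x y. act (prod_list (map \<phi> w)) x = Some y \<longrightarrow>
         (pair_step G R \<phi> act)\<^sup>*\<^sup>* (w, x) ([], y)"
    using assms(4) unfolding confluent_action_def by (elim exE conjE)
  interpret presented_action G R \<phi> act
  proof
    show "\<exists>!q. normal_form_of (pair_step G R \<phi> act) (w, x) q" if "w \<in> lists G" for w x
      using pres(3) that by (elim ballE allE) auto
    show "(pair_step G R \<phi> act)\<^sup>*\<^sup>* (w, x) ([], y)"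
      if "w \<in> lists G" "act (prod_list (map \<phi> w)) x = Some y" for w x y
      using pres(4) that by (elim ballE allE) auto
  qed (fact pres(1,2))+
  show ?thesis using assms(1,3,5,6) by (rule separated_glob_dist)
qed

end
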